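(* Let $q\geq 2$ be an integer and let $A_q=\{q^n+n:n\in\mathbb{N}\}$. Then $(\mathbb{Z},+,A_q)$ is interdefinable with $(\mathbb{Z},+,<,q^x)$, where $q^x$ denotes the function $x\mapsto q^x$ with domain $\mathbb{N}$. In particular, $(\mathbb{Z},+,A_q)$ is unstable.
   Context: $(\mathbb{Z},+,A_q)$ is the expansion of $(\mathbb{Z},+)$ by a unary predicate for $A_q$. Two structures with the same universe are interdefinable if they have the same definable (with parameters) sets. $\mathbb{N}$ includes $0$. *)

theory Defs
  imports Main
begin

section \<open>First-order logic\<close>

datatype 'f tm = Var nat | App 'f "'f tm list"

datatype ('f, 'r) fm =
    Equal "'f tm" "'f tm"
  | Atom 'r "'f tm list"
  | Neg "('f, 'r) fm"
  | Conj "('f, 'r) fm" "('f, 'r) fm"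
  | Exists nat "('f, 'r) fm"

text \<open>
  A structure carries the arities of its symbols; its universe is all of the type \<^typ>\<open>'a\<close>.
  The values of an interpretation on lists of the wrong length are irrelevant, as only
  formulas respecting the arities (\<open>wf_fm\<close> below) are ever considered.
\<close>

record ('f, 'r, 'a) struct =
  fun_arity :: "'f \<Rightarrow> nat"
  rel_arity :: "'r \<Rightarrow> nat"
  fun_interp :: "'f \<Rightarrow> 'a list \<Rightarrow> 'a"
  rel_interp :: "'r \<Rightarrow> 'a list \<Rightarrow> bool"

fun wf_tm :: "('f, 'r, 'a) struct \<Rightarrow> 'f tm \<Rightarrow> bool" where
  "wf_tm M (Var i) \<longleftrightarrow> True"
| "wf_tm M (App f ts) \<longleftrightarrow> length ts = fun_arity M f \<and> (\<forall>t \<in> set ts. wf_tm M t)"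

primrec wf_fm :: "('f, 'r, 'a) struct \<Rightarrow> ('f, 'r) fm \<Rightarrow> bool" where
  "wf_fm M (Equal s t) \<longleftrightarrow> wf_tm M s \<and> wf_tm M t"
| "wf_fm M (Atom r ts) \<longleftrightarrow> length ts = rel_arity M r \<and> (\<forall>t \<in> set ts. wf_tm M t)"
| "wf_fm M (Neg \<phi>) \<longleftrightarrow> wf_fm M \<phi>"
| "wf_fm M (Conj \<phi> \<psi>) \<longleftrightarrow> wf_fm M \<phi> \<and> wf_fm M \<psi>"
| "wf_fm M (Exists i \<phi>) \<longleftrightarrow> wf_fm M \<phi>"

fun tm_vars :: "'f tm \<Rightarrow> nat set" where
  "tm_vars (Var i) = {i}"
| "tm_vars (App f ts) = (\<Union>t \<in> set ts. tm_vars t)"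

primrec free_vars :: "('f, 'r) fm \<Rightarrow> nat set" where
  "free_vars (Equal s t) = tm_vars s \<union> tm_vars t"
| "free_vars (Atom r ts) = (\<Union>t \<in> set ts. tm_vars t)"
| "free_vars (Neg \<phi>) = free_vars \<phi>"
| "free_vars (Conj \<phi> \<psi>) = free_vars \<phi> \<union> free_vars \<psi>"
| "free_vars (Exists i \<phi>) = free_vars \<phi> - {i}"

primrec tm_val :: "('f, 'r, 'a) struct \<Rightarrow> (nat \<Rightarrow> 'a) \<Rightarrow> 'f tm \<Rightarrow> 'a" where
  "tm_val M e (Var i) = e i"
| "tm_val M e (App f ts) = fun_interp M f (map (tm_val M e) ts)"

primrec sat :: "('f, 'r, 'a) struct \<Rightarrow> (nat \<Rightarrow> 'a) \<Rightarrow> ('f, 'r) fm \<Rightarrow> bool" where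
  "sat M e (Equal s t) \<longleftrightarrow> tm_val M e s = tm_val M e t"
| "sat M e (Atom r ts) \<longleftrightarrow> rel_interp M r (map (tm_val M e) ts)"
| "sat M e (Neg \<phi>) \<longleftrightarrow> \<not> sat M e \<phi>"
| "sat M e (Conj \<phi> \<psi>) \<longleftrightarrow> sat M e \<phi> \<and> sat M e \<psi>"
| "sat M e (Exists i \<phi>) \<longleftrightarrow> (\<exists>x. sat M (e(i := x)) \<phi>)"

section \<open>Definability with parameters\<close>

text \<open>
  Subsets of the \<open>n\<close>-th Cartesian power of the universe are sets of lists of length \<open>n\<close>.
  The variables below \<open>n\<close> stand for the coordinates; the remaining free variables of the
  formula are filled with the parameters \<open>ps\<close>.
\<close>

definition definable :: "('f, 'r, 'a) struct \<Rightarrow> nat \<Rightarrow> 'a list set \<Rightarrow> bool" where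
  "definable M n X \<longleftrightarrow>
    (\<exists>\<phi> ps. wf_fm M \<phi> \<and> free_vars \<phi> \<subseteq> {..<n + length ps} \<and>
       X = {xs. length xs = n \<and> sat M (\<lambda>i. (xs @ ps) ! i) \<phi>})"

definition interdefinable :: "('f, 'r, 'a) struct \<Rightarrow> ('g, 's, 'a) struct \<Rightarrow> bool" where
  "interdefinable M N \<longleftrightarrow> (\<forall>n X. definable M n X \<longleftrightarrow> definable N n X)"

section \<open>Stability\<close>

definition elem_equiv :: "('f, 'r, 'a) struct \<Rightarrow> ('f, 'r, 'b) struct \<Rightarrow> bool" where
  "elem_equiv M N \<longleftrightarrow>
    fun_arity M = fun_arity N \<and> rel_arity M = rel_arity N \<and>
    (\<forall>\<phi>. wf_fm M \<phi> \<and> free_vars \<phi> = {} \<longrightarrow> (\<forall>d e. sat M d \<phi> \<longleftrightarrow> sat N e \<phi>))"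

text \<open>
  The formula \<open>\<phi>(x, y)\<close>, where \<open>x\<close> is the tuple of the first \<open>m\<close> variables and \<open>y\<close> that
  of the next \<open>n\<close>, orders two infinite sequences of tuples from \<open>N\<close>.
\<close>

definition order_property :: "('f, 'r, 'a) struct \<Rightarrow> ('f, 'r) fm \<Rightarrow> nat \<Rightarrow> nat \<Rightarrow> bool" where
  "order_property N \<phi> m n \<longleftrightarrow>
    (\<exists>a b :: nat \<Rightarrow> 'a list.
       (\<forall>i. length (a i) = m) \<and> (\<forall>j. length (b j) = n) \<and>
       (\<forall>i j. sat N (\<lambda>k. (a i @ b j) ! k) \<phi> \<longleftrightarrow> i < j))"

text \<open>
  \<open>M\<close> is stable if its complete theory is, that is, if no formula has the order property in
  a model \<open>N\<close> of that theory. HOL does not allow \<open>N\<close> to range over all types; it ranges over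
  the structures whose universe is the type of \<open>M\<close>. If the language has at most as many
  symbols as \<open>M\<close> has elements, or is countable, this loses nothing: if \<open>M\<close> is finite,
  all models of its theory are isomorphic to \<open>M\<close>, and if \<open>M\<close> is infinite, a formula with
  the order property in some model has it in one of the cardinality of \<open>M\<close>, by
  Loewenheim-Skolem.
\<close>

definition stable_structure :: "('f, 'r, 'a) struct \<Rightarrow> bool" where
  "stable_structure M \<longleftrightarrow>
    \<not> (\<exists>(N :: ('f, 'r, 'a) struct) \<phi> m n.
         elem_equiv M N \<and> wf_fm N \<phi> \<and> free_vars \<phi> \<subseteq> {..<m + n} \<and> order_property N \<phi> m n)"

section \<open>The expansions of the group of integers\<close>

datatype add_sym = Add

primrec add_interp :: "add_sym \<Rightarrow> int list \<Rightarrow> int" where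
  "add_interp Add xs = xs ! 0 + xs ! 1"

datatype pred_sym = InPred

primrec pred_interp :: "int set \<Rightarrow> pred_sym \<Rightarrow> int list \<Rightarrow> bool" where
  "pred_interp A InPred xs \<longleftrightarrow> xs ! 0 \<in> A"

definition Z_add_pred :: "int set \<Rightarrow> (add_sym, pred_sym, int) struct" where
  "Z_add_pred A =
    \<lparr>fun_arity = (\<lambda>_. 2), rel_arity = (\<lambda>_. 1),
     fun_interp = add_interp, rel_interp = pred_interp A\<rparr>"

datatype less_pow_sym = Less | Pow_Graph

text \<open>
  The function \<open>x \<mapsto> q\<^sup>x\<close> is partial on the integers (its domain is the set of natural
  numbers), so it enters the language through its graph.
\<close>

primrec less_pow_interp :: "int \<Rightarrow> less_pow_sym \<Rightarrow> int list \<Rightarrow> bool" where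
  "less_pow_interp q Less xs \<longleftrightarrow> xs ! 0 < xs ! 1"
| "less_pow_interp q Pow_Graph xs \<longleftrightarrow> (\<exists>n :: nat. xs ! 0 = int n \<and> xs ! 1 = q ^ n)"

definition Z_add_less_pow :: "int \<Rightarrow> (add_sym, less_pow_sym, int) struct" where
  "Z_add_less_pow q =
    \<lparr>fun_arity = (\<lambda>_. 2), rel_arity = (\<lambda>_. 2),
     fun_interp = add_interp, rel_interp = less_pow_interp q\<rparr>"

definition A_set :: "int \<Rightarrow> int set" where
  "A_set q = {q ^ n + int n | n :: nat. True}"

end

theory Submission
  imports Defs
begin

text \<open>
  Put \<open>a\<^sub>n = q\<^sup>n + n\<close>. The linear recurrence
  \<open>a\<^bsub>n+2\<^esub> + q a\<^sub>n + q = (q + 1) a\<^bsub>n+1\<^esub> + 1\<close> has no solutions in \<open>A\<^sub>q\<close> other than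
  consecutive triples, so the successor \<open>a\<^sub>n \<mapsto> a\<^bsub>n+1\<^esub>\<close> is definable in \<open>(\<int>, +, A\<^sub>q)\<close>
  from the parameter 1. Since \<open>q a\<^sub>n + 1 - a\<^bsub>n+1\<^esub> = (q - 1) n\<close>, the map \<open>a\<^sub>n \<mapsto> n\<close> is
  definable as well, and with it the set of natural numbers, the order, and
  \<open>n \<mapsto> a\<^sub>n - n = q\<^sup>n\<close>. The definable order refutes stability.
\<close>

section \<open>Coincidence and transfer of definability\<close>

lemma tm_val_cong:
  assumes "\<And>i. i \<in> tm_vars t \<Longrightarrow> d i = e i"
  shows "tm_val M d t = tm_val M e t"
  using assms
proof (induction t)
  case (App f ts)
  then have "map (tm_val M d) ts = map (tm_val M e) ts"
    by (intro map_cong) auto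
  then show ?case by (simp del: map_eq_conv)
qed simp

lemma sat_cong:
  assumes "\<And>i. i \<in> free_vars \<phi> \<Longrightarrow> d i = e i"
  shows "sat M d \<phi> \<longleftrightarrow> sat M e \<phi>"
  using assms
proof (induction \<phi> arbitrary: d e)
  case (Equal s t)
  then show ?case
    using tm_val_cong[of s d e M] tm_val_cong[of t d e M] by simp
next
  case (Atom r ts)
  then have "map (tm_val M d) ts = map (tm_val M e) ts"
    by (intro map_cong tm_val_cong) auto
  then show ?case by (simp del: map_eq_conv)
next
  case (Neg \<phi>)
  from Neg.IH[of d e] Neg.prems show ?case by simp
next
  case (Conj \<phi> \<psi>)
  from Conj.IH(1)[of d e] Conj.IH(2)[of d e] Conj.prems show ?case by simp
next
  case (Exists i \<phi>)
  have "sat M (d(i := x)) \<phi> = sat M (e(i := x)) \<phi>" for x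
    by (rule Exists.IH) (use Exists.prems in auto)
  then show ?case by simp
qed

text \<open>Stability speaks of all models of the theory; this lets the structure itself serve as
  the model with the order property.\<close>

lemma elem_equiv_refl: "elem_equiv M M"
proof -
  have "sat M d \<phi> \<longleftrightarrow> sat M e \<phi>" if "free_vars \<phi> = {}" for \<phi> d e
    by (rule sat_cong) (simp add: that)
  then show ?thesis unfolding elem_equiv_def by simp
qed

text \<open>Bound variables are counted too: a variable chosen outside this set is neither captured
  nor overwritten by a quantifier of the formula.\<close>

primrec fm_vars :: "('f, 'r) fm \<Rightarrow> nat set" where
  "fm_vars (Equal s t) = tm_vars s \<union> tm_vars t"
| "fm_vars (Atom r ts) = (\<Union>t \<in> set ts. tm_vars t)"
| "fm_vars (Neg \<phi>) = fm_vars \<phi>"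
| "fm_vars (Conj \<phi> \<psi>) = fm_vars \<phi> \<union> fm_vars \<psi>"
| "fm_vars (Exists i \<phi>) = insert i (fm_vars \<phi>)"

lemma finite_tm_vars: "finite (tm_vars t)"
  by (induction t) auto

lemma finite_fm_vars: "finite (fm_vars \<phi>)"
  by (induction \<phi>) (auto simp: finite_tm_vars)

primrec map_atoms :: "('r \<Rightarrow> 'f tm list \<Rightarrow> ('f, 's) fm) \<Rightarrow> ('f, 'r) fm \<Rightarrow> ('f, 's) fm" where
  "map_atoms F (Equal s t) = Equal s t"
| "map_atoms F (Atom r ts) = F r ts"
| "map_atoms F (Neg \<phi>) = Neg (map_atoms F \<phi>)"
| "map_atoms F (Conj \<phi> \<psi>) = Conj (map_atoms F \<phi>) (map_atoms F \<psi>)"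
| "map_atoms F (Exists i \<phi>) = Exists i (map_atoms F \<phi>)"

text \<open>
  In the formula \<open>F k r ts\<close> defining an atom of \<open>N\<close>, the variable \<open>k\<close> stands for the
  parameter \<open>c\<close>, and the variables from \<open>k\<close> on do not occur in \<open>ts\<close>.
\<close>

locale atom_interpretation =
  fixes M :: "('f, 's, 'a) struct" and N :: "('f, 'r, 'a) struct"
    and c :: 'a and F :: "nat \<Rightarrow> 'r \<Rightarrow> 'f tm list \<Rightarrow> ('f, 's) fm"
  assumes fun_arity_eq: "fun_arity M = fun_arity N"
    and fun_interp_eq: "fun_interp M = fun_interp N"
    and wf_F: "\<lbrakk>length ts = rel_arity N r; \<forall>t \<in> set ts. wf_tm M t\<rbrakk> \<Longrightarrow> wf_fm M (F k r ts)"
    and free_vars_F: "length ts = rel_arity N r \<Longrightarrow>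
      free_vars (F k r ts) \<subseteq> insert k (\<Union>t \<in> set ts. tm_vars t)"
    and sat_F: "\<lbrakk>length ts = rel_arity N r; (\<Union>t \<in> set ts. tm_vars t) \<subseteq> {..<k}; e k = c\<rbrakk> \<Longrightarrow>
      sat M e (F k r ts) \<longleftrightarrow> rel_interp N r (map (tm_val M e) ts)"
begin

lemma wf_tm_eq: "wf_tm M t = wf_tm N t"
  by (induction t) (simp_all add: fun_arity_eq)

lemma tm_val_eq: "tm_val M e t = tm_val N e t"
proof (induction t)
  case (App f ts)
  then have "map (tm_val M e) ts = map (tm_val N e) ts" by simp
  then show ?case by (simp add: fun_interp_eq del: map_eq_conv)
qed simp

lemma wf_map_atoms: "wf_fm N \<phi> \<Longrightarrow> wf_fm M (map_atoms (F k) \<phi>)"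
  by (induction \<phi>) (auto simp: wf_tm_eq wf_F)

lemma free_vars_map_atoms:
  "wf_fm N \<phi> \<Longrightarrow> free_vars (map_atoms (F k) \<phi>) \<subseteq> insert k (free_vars \<phi>)"
proof (induction \<phi>)
  case (Atom r ts)
  then show ?case using free_vars_F[of ts r k] by simp
qed auto

text \<open>The bound on \<open>fm_vars\<close> carries the induction through quantifiers: a
  quantified variable lies below \<open>k\<close>, so updating it preserves
  \<open>e k = c\<close>.\<close>

lemma sat_map_atoms:
  "\<lbrakk>wf_fm N \<phi>; fm_vars \<phi> \<subseteq> {..<k}; e k = c\<rbrakk> \<Longrightarrow> sat M e (map_atoms (F k) \<phi>) \<longleftrightarrow> sat N e \<phi>"
proof (induction \<phi> arbitrary: e)
  case (Equal s t)
  then show ?case by (simp add: tm_val_eq)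
next
  case (Atom r ts)
  moreover have "map (tm_val M e) ts = map (tm_val N e) ts" by (simp add: tm_val_eq)
  ultimately show ?case using sat_F[of ts r k e] by (simp del: map_eq_conv)
qed auto

text \<open>Replace every atom by its defining formula and append \<open>c\<close> to the
  parameters.\<close>

lemma definable_transfer:
  assumes "definable N n X"
  shows "definable M n X"
proof -
  obtain \<phi> ps where wf: "wf_fm N \<phi>" and fv: "free_vars \<phi> \<subseteq> {..<n + length ps}"
    and X: "X = {xs. length xs = n \<and> sat N (\<lambda>i. (xs @ ps) ! i) \<phi>}"
    using assms unfolding definable_def by blast
  obtain b where b: "fm_vars \<phi> \<subseteq> {..<b}"
    using finite_fm_vars[of \<phi>] unfolding finite_nat_set_iff_bounded by blast
  \<comment> \<open>This index lies beyond the coordinates, the old parameters and every variable of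
    \<open>\<phi>\<close>. The \<open>b\<close> padding entries of \<open>ps'\<close> serve to place
    the final \<open>c\<close> exactly at position \<open>k\<close>.\<close>
  define k where "k = n + length ps + b"
  define ps' where "ps' = ps @ replicate b c @ [c]"
  have len: "n + length ps' = Suc k" by (simp add: ps'_def k_def)
  have "sat M (\<lambda>i. (xs @ ps') ! i) (map_atoms (F k) \<phi>) \<longleftrightarrow> sat N (\<lambda>i. (xs @ ps) ! i) \<phi>"
    if "length xs = n" for xs
  proof -
    have "(xs @ ps') ! k = c"
      using that by (simp add: ps'_def k_def nth_append)
    moreover have "fm_vars \<phi> \<subseteq> {..<k}" using b by (auto simp: k_def)
    ultimately have "sat M (\<lambda>i. (xs @ ps') ! i) (map_atoms (F k) \<phi>) \<longleftrightarrow>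
        sat N (\<lambda>i. (xs @ ps') ! i) \<phi>"
      by (intro sat_map_atoms wf)
    also have "\<dots> \<longleftrightarrow> sat N (\<lambda>i. (xs @ ps) ! i) \<phi>"
      by (rule sat_cong) (use fv that in \<open>auto simp: ps'_def nth_append\<close>)
    finally show ?thesis .
  qed
  then have "X = {xs. length xs = n \<and> sat M (\<lambda>i. (xs @ ps') ! i) (map_atoms (F k) \<phi>)}"
    unfolding X by blast
  moreover have "free_vars (map_atoms (F k) \<phi>) \<subseteq> {..<n + length ps'}"
    using free_vars_map_atoms[OF wf, of k] fv unfolding len by (auto simp: k_def)
  ultimately show ?thesis
    unfolding definable_def using wf_map_atoms[OF wf] by blast
qed

end

section \<open>Arithmetic of the recurrence\<close>

text \<open>Growth excludes every other position of \<open>m\<close>. If \<open>l > m\<close>, the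
  term \<open>q * q ^ l\<close> makes the left side too large. If \<open>l = m\<close>, two terms of
  the sequence would differ by \<open>q - 1\<close>, but distinct terms differ by at least
  \<open>q\<close>. If \<open>m \<ge> l + 2\<close>, the left side is too small for
  \<open>k \<le> m + 1\<close> and too large for larger \<open>k\<close>.\<close>

lemma consecutive_of_recurrence:
  fixes q :: int
  assumes q: "q \<ge> 2"
    and eq: "(q ^ k + int k) + q * (q ^ l + int l) + q = (q + 1) * (q ^ m + int m) + 1"
  shows "m = Suc l"
proof (rule ccontr)
  assume neq: "m \<noteq> Suc l"
  have mono: "q ^ i \<le> q ^ j" if "i \<le> j" for i j :: nat
    using q that by (intro power_increasing) auto
  have pos: "q ^ i \<ge> 1" for i :: nat using q by simp
  have ge: "q ^ i \<ge> 2 * int i" for i :: nat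
  proof (induction i)
    case (Suc i)
    have "q * q ^ i \<ge> 2 * q ^ i" using q pos[of i] by (intro mult_right_mono) auto
    \<comment> \<open>For \<open>i = 0\<close> both sides are 2; for \<open>i \<ge> 1\<close> the
      induction hypothesis gives \<open>4 * i\<close>, which is at least
      \<open>2 * (i + 1)\<close>.\<close>
    moreover have "2 * q ^ i \<ge> 2 * int (Suc i)"
      using Suc pos[of i] by (cases "i = 0") auto
    ultimately show ?case unfolding power_Suc by linarith
  qed simp
  have eq': "q ^ k + int k + q * q ^ l + q * int l + q = q * q ^ m + q ^ m + q * int m + int m + 1"
    using eq by (simp add: algebra_simps)
  consider "l > m" | "l = m" | "Suc (Suc l) \<le> m" using neq by linarith
  then show False
  proof cases
    case 1
    have a: "q * q ^ l \<ge> q * (q * q ^ m)"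
      using mono[of "Suc m" l] 1 q by simp
    have b: "q * (q * q ^ m) \<ge> 2 * (q * q ^ m)" "q * q ^ m \<ge> 2 * q ^ m"
      using q pos[of m] by (auto intro!: mult_right_mono)
    have "q * int l \<ge> q * (int m + 1)" using 1 q by (intro mult_left_mono) auto
    then have "q * int l \<ge> q * int m + q" by (simp add: algebra_simps)
    with a b eq' pos[of k] ge[of m] q show False by linarith
  next
    case 2
    with eq' have e: "q ^ k + int k + q = q ^ m + int m + 1" by simp
    show False
    proof (cases "m \<le> k")
      case True
      then show ?thesis using e mono[of m k] q by linarith
    next
      case False
      then have "q ^ m \<ge> q * q ^ k" using mono[of "Suc k" m] by simp
      moreover have "(q - 1) * q ^ k \<ge> (q - 1) * 1"
        using q pos[of k] by (intro mult_left_mono) auto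
      ultimately have "q ^ m \<ge> q ^ k + q - 1" by (simp add: algebra_simps)
      then show ?thesis using e False by linarith
    qed
  next
    case 3
    have lm: "q * q ^ l < q ^ m"
    proof -
      have "q ^ Suc l < q ^ m" using q 3 by (intro power_strict_increasing) auto
      then show ?thesis by simp
    qed
    have "q * int m \<ge> q * (int l + 2)" using 3 q by (intro mult_left_mono) auto
    then have lin: "q * int m \<ge> q * int l + 2 * q" by (simp add: algebra_simps)
    show False
    proof (cases "k \<le> Suc m")
      case True
      then have "q ^ k \<le> q * q ^ m" using mono[of k "Suc m"] by simp
      then show ?thesis using eq' lm lin True q by linarith
    next
      case False
      then have kk: "q ^ k \<ge> q * (q * q ^ m)" using mono[of "Suc (Suc m)" k] by simp
      \<comment> \<open>The goal is that \<open>q * q * q ^ m\<close> dominates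
        \<open>q * q ^ m + q ^ m + q * m\<close>. Their difference is rewritten in terms of
        \<open>q ^ m - 2 * m\<close> and \<open>m\<close>, both nonnegative. These factorizations
        show that the two coefficients are nonnegative from \<open>q = 2\<close> on.\<close>
      have "(q - 2) * (q + 1) \<ge> 0" "(q - 2) * (2 * q + 1) \<ge> 0" using q by simp_all
      then have coeffs: "q * q - q - 1 \<ge> 0" "2 * (q * q) - 3 * q - 2 \<ge> 0"
        by (simp_all add: algebra_simps)
      have "(q * q - q - 1) * (q ^ m - 2 * int m) \<ge> 0"
        using coeffs(1) ge[of m] by (intro mult_nonneg_nonneg) auto
      moreover have "(2 * (q * q) - 3 * q - 2) * int m \<ge> 0"
        using coeffs(2) by (intro mult_nonneg_nonneg) auto
      moreover have "q * (q * q ^ m) - (q * q ^ m + q ^ m + q * int m) =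
          (q * q - q - 1) * (q ^ m - 2 * int m) + (2 * (q * q) - 3 * q - 2) * int m"
        by (simp add: algebra_simps)
      ultimately have "q * (q * q ^ m) \<ge> q * q ^ m + q ^ m + q * int m" by linarith
      moreover have "q * q ^ l > 0" "q * int l \<ge> 0" using q by simp_all
      ultimately show ?thesis using eq' kk False q by linarith
    qed
  qed
qed

text \<open>The witness \<open>c\<close> certifies through the recurrence that \<open>b\<close>
  follows \<open>a\<close> in the sequence. The second equation then forces \<open>x\<close> to be
  the index of \<open>a\<close>, and the third reads off the power. All terms are arranged with
  positive coefficients, so that addition and the parameter 1 suffice to express them.\<close>

lemma power_graph_iff:
  fixes q x y :: int
  assumes q: "q \<ge> 2"
  shows "(\<exists>n. x = int n \<and> y = q ^ n) \<longleftrightarrow>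
    (\<exists>a \<in> A_set q. \<exists>b \<in> A_set q. \<exists>c \<in> A_set q.
      c + q * a + q = (q + 1) * b + 1 \<and> (q - 1) * x + b = 1 + q * a \<and> a = x + y)"
    (is "?L \<longleftrightarrow> ?R")
proof
  assume ?L
  then obtain n where n: "x = int n" "y = q ^ n" by blast
  let ?a = "\<lambda>n. q ^ n + int n"
  have "?a n \<in> A_set q" for n by (auto simp: A_set_def)
  moreover have "?a (n + 2) + q * ?a n + q = (q + 1) * ?a (n + 1) + 1"
    "(q - 1) * x + ?a (n + 1) = 1 + q * ?a n" "?a n = x + y"
    using n by (simp_all add: algebra_simps)
  ultimately show ?R by blast
next
  assume ?R
  then obtain k l m where
    eq: "(q ^ k + int k) + q * (q ^ l + int l) + q = (q + 1) * (q ^ m + int m) + 1"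
    and x: "(q - 1) * x + (q ^ m + int m) = 1 + q * (q ^ l + int l)"
    and y: "q ^ l + int l = x + y"
    by (auto simp: A_set_def)
  have "(q - 1) * x = (q - 1) * int l"
    using x unfolding consecutive_of_recurrence[OF q eq] by (simp add: algebra_simps)
  then have "x = int l" using q by simp
  then show ?L using y by auto
qed

section \<open>The defining formulas\<close>

abbreviation plus_tm :: "add_sym tm \<Rightarrow> add_sym tm \<Rightarrow> add_sym tm" where
  "plus_tm s t \<equiv> App Add [s, t]"

text \<open>There is no term for 0, so \<open>times_tm n t\<close> denotes \<open>(n + 1) t\<close>.\<close>

primrec times_tm :: "nat \<Rightarrow> add_sym tm \<Rightarrow> add_sym tm" where
  "times_tm 0 t = t"
| "times_tm (Suc n) t = plus_tm t (times_tm n t)"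

lemma tm_vars_times_tm [simp]: "tm_vars (times_tm n t) = tm_vars t"
  by (induction n) auto

lemma Z_add_pred_simps [simp]:
  "fun_arity (Z_add_pred A) = (\<lambda>_. 2)" "fun_interp (Z_add_pred A) = add_interp"
  "rel_arity (Z_add_pred A) = (\<lambda>_. 1)" "rel_interp (Z_add_pred A) = pred_interp A"
  by (simp_all add: Z_add_pred_def)

lemma Z_add_less_pow_simps [simp]:
  "fun_arity (Z_add_less_pow q) = (\<lambda>_. 2)" "fun_interp (Z_add_less_pow q) = add_interp"
  "rel_arity (Z_add_less_pow q) = (\<lambda>_. 2)" "rel_interp (Z_add_less_pow q) = less_pow_interp q"
  by (simp_all add: Z_add_less_pow_def)

lemma wf_times_tm [simp]: "wf_tm (Z_add_pred A) (times_tm n t) = wf_tm (Z_add_pred A) t"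
  by (induction n) auto

lemma tm_val_times_tm [simp]:
  "tm_val (Z_add_pred A) e (times_tm n t) = (int n + 1) * tm_val (Z_add_pred A) e t"
  by (induction n) (auto simp: algebra_simps)

text \<open>The right side of \<open>power_graph_iff\<close> as a formula. By the shift in
  \<open>times_tm\<close>, the indices \<open>n - 1\<close>, \<open>n\<close> and
  \<open>Suc n\<close> give the factors \<open>q - 1\<close>, \<open>q\<close> and
  \<open>q + 1\<close> when \<open>q \<ge> 2\<close>.\<close>

definition pow_fm :: "int \<Rightarrow> nat \<Rightarrow> add_sym tm \<Rightarrow> add_sym tm \<Rightarrow> (add_sym, pred_sym) fm" where
  "pow_fm q k s t =
    (let one = Var k; a = Var (k + 1); b = Var (k + 2); c = Var (k + 3); n = nat q - 1 in
     Exists (k + 1) (Conj (Atom InPred [a])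
      (Exists (k + 2) (Conj (Atom InPred [b])
        (Exists (k + 3) (Conj (Atom InPred [c])
          (Conj (Equal (plus_tm (plus_tm c (times_tm n a)) (times_tm n one))
                       (plus_tm (times_tm (Suc n) b) one))
          (Conj (Equal (plus_tm (times_tm (n - 1) s) b) (plus_tm one (times_tm n a)))
                (Equal a (plus_tm s t))))))))))"

lemma wf_pow_fm [simp]:
  "wf_fm (Z_add_pred A) (pow_fm q k s t) \<longleftrightarrow> wf_tm (Z_add_pred A) s \<and> wf_tm (Z_add_pred A) t"
  by (auto simp: pow_fm_def Let_def)

lemma free_vars_pow_fm: "free_vars (pow_fm q k s t) \<subseteq> insert k (tm_vars s \<union> tm_vars t)"
  by (auto simp: pow_fm_def Let_def)

text \<open>Freshness excludes only the three bound variables, which leaves \<open>k + 4\<close> and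
  \<open>k + 5\<close> available as arguments in \<open>less_fm\<close>.\<close>

lemma sat_pow_fm:
  assumes q: "q \<ge> 2" and one: "e k = 1"
    and fresh: "(tm_vars s \<union> tm_vars t) \<inter> {k + 1, k + 2, k + 3} = {}"
  shows "sat (Z_add_pred (A_set q)) e (pow_fm q k s t) \<longleftrightarrow>
    (\<exists>n. tm_val (Z_add_pred (A_set q)) e s = int n \<and> tm_val (Z_add_pred (A_set q)) e t = q ^ n)"
proof -
  let ?M = "Z_add_pred (A_set q)"
  have s: "tm_val ?M (e(k + 1 := a, k + 2 := b, k + 3 := c)) s = tm_val ?M e s" for a b c
    by (rule tm_val_cong) (use fresh in auto)
  have t: "tm_val ?M (e(k + 1 := a, k + 2 := b, k + 3 := c)) t = tm_val ?M e t" for a b c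
    by (rule tm_val_cong) (use fresh in auto)
  \<comment> \<open>With \<open>q\<close> written as \<open>n + 2\<close>, the truncated
    subtractions in \<open>pow_fm\<close> evaluate to \<open>Suc n\<close> and
    \<open>n\<close>.\<close>
  obtain n where n: "nat q = Suc (Suc n)" "q = int n + 2"
    using q by (intro that[of "nat q - 2"]) auto
  have "sat ?M e (pow_fm q k s t) \<longleftrightarrow>
    (\<exists>a \<in> A_set q. \<exists>b \<in> A_set q. \<exists>c \<in> A_set q.
      c + (int (Suc n) + 1) * a + (int (Suc n) + 1) * 1 = (int (Suc (Suc n)) + 1) * b + 1 \<and>
      (int n + 1) * tm_val ?M e s + b = 1 + (int (Suc n) + 1) * a \<and>
      a = tm_val ?M e s + tm_val ?M e t)"
    by (simp add: pow_fm_def Let_def s[simplified] t[simplified] one n(1) Bex_def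
        del: times_tm.simps of_nat_Suc) blast
  also have "int (Suc n) + 1 = q" using n by simp
  also have "int (Suc (Suc n)) + 1 = q + 1" using n by simp
  also have "int n + 1 = q - 1" using n by simp
  finally show ?thesis unfolding power_graph_iff[OF q] by simp
qed

text \<open>Expresses \<open>t = s + x + 1\<close> for some natural number \<open>x\<close>. Being
  natural means lying in the domain of the power function, whose value at \<open>x\<close> is held
  by \<open>k + 5\<close>.\<close>

definition less_fm :: "int \<Rightarrow> nat \<Rightarrow> add_sym tm \<Rightarrow> add_sym tm \<Rightarrow> (add_sym, pred_sym) fm" where
  "less_fm q k s t =
    Exists (k + 4) (Exists (k + 5)
      (Conj (Equal (plus_tm (plus_tm s (Var (k + 4))) (Var k)) t)
            (pow_fm q k (Var (k + 4)) (Var (k + 5)))))"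

lemma wf_less_fm [simp]:
  "wf_fm (Z_add_pred A) (less_fm q k s t) \<longleftrightarrow> wf_tm (Z_add_pred A) s \<and> wf_tm (Z_add_pred A) t"
  by (auto simp: less_fm_def)

lemma free_vars_less_fm: "free_vars (less_fm q k s t) \<subseteq> insert k (tm_vars s \<union> tm_vars t)"
  using free_vars_pow_fm[of q k "Var (k + 4)" "Var (k + 5)"] by (auto simp: less_fm_def)

lemma sat_less_fm:
  assumes q: "q \<ge> 2" and one: "e k = 1"
    and fresh: "(tm_vars s \<union> tm_vars t) \<subseteq> {..<k}"
  shows "sat (Z_add_pred (A_set q)) e (less_fm q k s t) \<longleftrightarrow>
    tm_val (Z_add_pred (A_set q)) e s < tm_val (Z_add_pred (A_set q)) e t"
proof -
  let ?M = "Z_add_pred (A_set q)"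
  have s: "tm_val ?M (e(k + 4 := a, k + 5 := b)) s = tm_val ?M e s" for a b
    by (rule tm_val_cong) (use fresh in auto)
  have t: "tm_val ?M (e(k + 4 := a, k + 5 := b)) t = tm_val ?M e t" for a b
    by (rule tm_val_cong) (use fresh in auto)
  have "sat ?M (e(k + 4 := a, k + 5 := b)) (pow_fm q k (Var (k + 4)) (Var (k + 5))) \<longleftrightarrow>
      (\<exists>n. a = int n \<and> b = q ^ n)" for a b
    by (subst sat_pow_fm[OF q]) (use one in auto)
  then have "sat ?M e (less_fm q k s t) \<longleftrightarrow> (\<exists>n. tm_val ?M e s + int n + 1 = tm_val ?M e t)"
    using one by (auto simp: less_fm_def s[simplified] t[simplified])
  also have "\<dots> \<longleftrightarrow> tm_val ?M e s < tm_val ?M e t"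
    using zless_iff_Suc_zadd[of "tm_val ?M e s" "tm_val ?M e t"] by (auto simp: algebra_simps)
  finally show ?thesis .
qed

primrec less_pow_fm :: "int \<Rightarrow> nat \<Rightarrow> less_pow_sym \<Rightarrow> add_sym tm list \<Rightarrow> (add_sym, pred_sym) fm" where
  "less_pow_fm q k Less ts = less_fm q k (ts ! 0) (ts ! 1)"
| "less_pow_fm q k Pow_Graph ts = pow_fm q k (ts ! 0) (ts ! 1)"

lemma less_pow_interpretation:
  assumes q: "q \<ge> 2"
  shows "atom_interpretation (Z_add_pred (A_set q)) (Z_add_less_pow q) 1 (less_pow_fm q)"
proof
  fix ts :: "add_sym tm list" and r k
  assume "length ts = rel_arity (Z_add_less_pow q) r"
  then obtain s t where ts: "ts = [s, t]"
    by (auto simp: numeral_2_eq_2 length_Suc_conv)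
  show "wf_fm (Z_add_pred (A_set q)) (less_pow_fm q k r ts)"
    if "\<forall>t \<in> set ts. wf_tm (Z_add_pred (A_set q)) t"
    using that by (cases r) (auto simp: ts)
  show "free_vars (less_pow_fm q k r ts) \<subseteq> insert k (\<Union>t \<in> set ts. tm_vars t)"
    using free_vars_less_fm[of q k s t] free_vars_pow_fm[of q k s t] by (cases r) (auto simp: ts)
  fix e :: "nat \<Rightarrow> int"
  assume fresh: "(\<Union>t \<in> set ts. tm_vars t) \<subseteq> {..<k}" and one: "e k = 1"
  have "(tm_vars s \<union> tm_vars t) \<inter> {k + 1, k + 2, k + 3} = {}" "tm_vars s \<union> tm_vars t \<subseteq> {..<k}"
    using fresh by (auto simp: ts)
  then show "sat (Z_add_pred (A_set q)) e (less_pow_fm q k r ts) \<longleftrightarrow>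
      rel_interp (Z_add_less_pow q) r (map (tm_val (Z_add_pred (A_set q)) e) ts)"
    using sat_less_fm[of q e k s t, OF q one] sat_pow_fm[of q e k s t, OF q one] by (cases r) (auto simp: ts)
qed simp_all

section \<open>Recovering \<open>A_set q\<close> from addition and the graph of the power
  function\<close>

definition A_fm :: "nat \<Rightarrow> pred_sym \<Rightarrow> add_sym tm list \<Rightarrow> (add_sym, less_pow_sym) fm" where
  "A_fm k r ts = Exists (k + 1) (Exists (k + 2)
     (Conj (Atom Pow_Graph [Var (k + 1), Var (k + 2)])
           (Equal (ts ! 0) (plus_tm (Var (k + 1)) (Var (k + 2))))))"

lemma A_interpretation:
  "atom_interpretation (Z_add_less_pow q) (Z_add_pred (A_set q)) c A_fm"
proof
  fix ts :: "add_sym tm list" and r k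
  assume "length ts = rel_arity (Z_add_pred (A_set q)) r"
  then obtain t where ts: "ts = [t]"
    by (auto simp: length_Suc_conv)
  show "wf_fm (Z_add_less_pow q) (A_fm k r ts)"
    if "\<forall>t \<in> set ts. wf_tm (Z_add_less_pow q) t"
    using that by (auto simp: ts A_fm_def)
  show "free_vars (A_fm k r ts) \<subseteq> insert k (\<Union>t \<in> set ts. tm_vars t)"
    by (auto simp: ts A_fm_def)
  fix e :: "nat \<Rightarrow> int"
  assume "(\<Union>t \<in> set ts. tm_vars t) \<subseteq> {..<k}"
  then have t: "tm_val (Z_add_less_pow q) (e(k + 1 := a, k + 2 := b)) t = tm_val (Z_add_less_pow q) e t"
    for a b by (intro tm_val_cong) (auto simp: ts)
  show "sat (Z_add_less_pow q) e (A_fm k r ts) \<longleftrightarrow>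
      rel_interp (Z_add_pred (A_set q)) r (map (tm_val (Z_add_less_pow q) e) ts)"
    by (cases r) (auto simp: ts A_fm_def A_set_def t[simplified] algebra_simps)
qed simp_all

lemma interdefinable_A_set:
  assumes "q \<ge> 2"
  shows "interdefinable (Z_add_pred (A_set q)) (Z_add_less_pow q)"
  unfolding interdefinable_def
  using atom_interpretation.definable_transfer[OF less_pow_interpretation[OF assms]]
    atom_interpretation.definable_transfer[OF A_interpretation] by blast

section \<open>Failure of stability through the definable order\<close>

lemma order_property_less_fm:
  assumes q: "q \<ge> 2"
  shows "order_property (Z_add_pred (A_set q)) (less_fm q 2 (Var 0) (Var 1)) 1 2"
  unfolding order_property_def
proof (intro exI conjI allI)
  fix i j :: nat
  \<comment> \<open>The order property admits no separate parameters, so the parameter 1 travels as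
    a constant second entry of each right-hand tuple, at variable 2.\<close>
  show "sat (Z_add_pred (A_set q)) (\<lambda>k. ([int i] @ [int j, 1]) ! k) (less_fm q 2 (Var 0) (Var 1)) \<longleftrightarrow>
      i < j"
    by (subst sat_less_fm[OF q]) auto
qed simp_all

theorem theorem4p8:
  fixes q :: int
  assumes "q \<ge> 2"
  shows "interdefinable (Z_add_pred (A_set q)) (Z_add_less_pow q)
    \<and> \<not> stable_structure (Z_add_pred (A_set q))"
proof
  show "interdefinable (Z_add_pred (A_set q)) (Z_add_less_pow q)"
    using interdefinable_A_set[OF assms] .
  have "free_vars (less_fm q 2 (Var 0) (Var 1)) \<subseteq> {..<1 + 2}"
    using free_vars_less_fm[of q 2 "Var 0" "Var 1"] by auto
  then show "\<not> stable_structure (Z_add_pred (A_set q))"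
    unfolding stable_structure_def
    using elem_equiv_refl order_property_less_fm[OF assms] wf_less_fm by fastforce
qed

end
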